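(* Let $A$ and $B$ be disjoint subsets of $V$, with $|\mathfrak{X}_{v}|\geq 2$ for $v\in V$, and let $L\subseteq B$. Then the MLL parameter $\lambda_{L}^{AB}$ may be decomposed as $$\lambda_{L}^{AB}=\lambda_{L}^{B}+f(\lambda_{A|B})$$ for a smooth function $f$ of the collection $\lambda_{A|B}$ (that is, for each $x_L\in\mathfrak{X}_L$ there is a smooth function $f=f_{L,x_L}$, not depending on the distribution $p$, such that $\lambda_L^{AB}(x_L)=\lambda_L^B(x_L)+f(\lambda_{A|B})$ for every strictly positive $p$), and $f(\lambda_{A|B})$ vanishes if $X_{A}\perp\!\!\!\perp X_{v}\mid X_{B\setminus\{v\}}$ for some $v\in L$.
   Context: $V$ is a finite index set; for $v\in V$, $X_v$ is a categorical variable with finite level set $\mathfrak{X}_v=\{0,1,\dots,|\mathfrak{X}_v|-1\}$. For $A\subseteq V$, $X_A=(X_v)_{v\in A}$ and $\mathfrak{X}_A=\prod_{v\in A}\mathfrak{X}_v$ (with $|\mathfrak{X}_\emptyset|=1$); for $x\in\mathfrak{X}_A$ and $B\subseteq A$, $x_B$ is the restriction of $x$ to $B$. The joint distribution $p=p_V$ of $X_V$ on $\mathfrak{X}_V$ is strictly positive, and $p_A$ denotes its marginal on $\mathfrak{X}_A$. Juxtaposition denotes union: $AB=A\cup B$. The symbol $\perp\!\!\!\perp$ denotes (conditional) independence under $p$. For $L\subseteq M\subseteq V$ and $x_L\in\mathfrak{X}_L$, define $$\nu_L^M(x_L)=\frac{1}{|\mathfrak{X}_{M\setminus L}|}\sum_{j_M\in\mathfrak{X}_M:\,j_L=x_L}\log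 p_M(j_M),\qquad \lambda_L^M(x_L)=\sum_{L'\subseteq L}(-1)^{|L\setminus L'|}\nu_{L'}^M(x_{L'}).$$ $\lambda_L^M=\{\lambda_L^M(x_L)\mid x_L\in\mathfrak{X}_L\}$ is called a marginal log-linear (MLL) parameter. For disjoint $A,B\subseteq V$, $\lambda_{A|B}$ denotes the collection $\{\lambda_{K}^{AB}\mid K\subseteq AB,\ K\cap A\neq\emptyset\}$ of all MLL parameters within the margin $AB$ whose effect $K$ contains some element of $A$. *)

theory Defs
  imports "HOL-Probability.Probability"
begin

text \<open>
  The level set of a variable \<open>v\<close> is \<open>{0, ..., d v - 1}\<close>. A cell of the margin \<open>A\<close> is a function
  on \<open>A\<close>, encoded as an extensional function (value \<open>undefined\<close> outside \<open>A\<close>), so that the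
  restriction \<open>x\<^sub>B\<close> is the library's \<open>restrict x B\<close> and \<open>cells d {}\<close> has exactly one element.
\<close>

definition cells :: "('v \<Rightarrow> nat) \<Rightarrow> 'v set \<Rightarrow> ('v \<Rightarrow> nat) set" where
  "cells d A = (\<Pi>\<^sub>E v\<in>A. {..<d v})"

definition marginal :: "('v \<Rightarrow> nat) pmf \<Rightarrow> 'v set \<Rightarrow> ('v \<Rightarrow> nat) pmf" where
  "marginal p A = map_pmf (\<lambda>x. restrict x A) p"

definition nu :: "('v \<Rightarrow> nat) \<Rightarrow> ('v \<Rightarrow> nat) pmf \<Rightarrow> 'v set \<Rightarrow> 'v set \<Rightarrow> ('v \<Rightarrow> nat) \<Rightarrow> real" where
  "nu d p M L x =
     1 / real (card (cells d (M - L))) *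
     (\<Sum>j \<in> {j \<in> cells d M. restrict j L = x}. ln (pmf (marginal p M) j))"

text \<open>The marginal log-linear parameter with margin \<open>M\<close> and effect \<open>L\<close>, at \<open>x \<in> cells d L\<close>.\<close>

definition mll :: "('v \<Rightarrow> nat) \<Rightarrow> ('v \<Rightarrow> nat) pmf \<Rightarrow> 'v set \<Rightarrow> 'v set \<Rightarrow> ('v \<Rightarrow> nat) \<Rightarrow> real" where
  "mll d p M L x = (\<Sum>L' \<in> Pow L. (-1) ^ card (L - L') * nu d p M L' (restrict x L'))"

text \<open>
  The collection \<open>\<lambda>\<^bsub>A|B\<^esub>\<close> is a vector with one real coordinate for each pair of an effect
  \<open>K \<subseteq> A \<union> B\<close> meeting \<open>A\<close> and a cell of \<open>K\<close>.
\<close>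

definition cond_mll_index :: "('v \<Rightarrow> nat) \<Rightarrow> 'v set \<Rightarrow> 'v set \<Rightarrow> ('v set \<times> ('v \<Rightarrow> nat)) set" where
  "cond_mll_index d A B = (SIGMA K : {K. K \<subseteq> A \<union> B \<and> K \<inter> A \<noteq> {}}. cells d K)"

definition cond_mll ::
  "('v \<Rightarrow> nat) \<Rightarrow> ('v \<Rightarrow> nat) pmf \<Rightarrow> 'v set \<Rightarrow> 'v set \<Rightarrow> 'v set \<times> ('v \<Rightarrow> nat) \<Rightarrow> real" where
  "cond_mll d p A B = (\<lambda>(K, x) \<in> cond_mll_index d A B. mll d p (A \<union> B) K x)"

text \<open>
  \<open>X\<^sub>A\<close> and \<open>X\<^sub>C\<close> are conditionally independent given \<open>X\<^sub>D\<close>: they are independent under the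
  conditional distribution of \<open>p\<close> given \<open>X\<^sub>D = z\<close>, for every \<open>z\<close> of positive probability.
\<close>

definition cond_indep :: "('v \<Rightarrow> nat) pmf \<Rightarrow> 'v set \<Rightarrow> 'v set \<Rightarrow> 'v set \<Rightarrow> bool" where
  "cond_indep p A C D \<longleftrightarrow>
     (\<forall>z \<in> set_pmf (marginal p D).
        prob_space.indep_var (measure_pmf (cond_pmf p {x. restrict x D = z}))
          (count_space UNIV) (\<lambda>x. restrict x A) (count_space UNIV) (\<lambda>x. restrict x C))"

text \<open>
  For a finite set \<open>I\<close>, the space of real vectors indexed by \<open>I\<close> is the set \<open>I \<rightarrow>\<^sub>E UNIV\<close> of
  extensional functions, with the (subspace) topology of pointwise convergence, which is the
  Euclidean one. \<open>Ck_on_coords I k f\<close> says that all iterated partial derivatives of \<open>f\<close> of order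
  at most \<open>k\<close> exist and are continuous on this whole space; in the recursive clause, \<open>g\<close> is the
  partial derivative of \<open>f\<close> in direction \<open>i\<close>.
\<close>

primrec Ck_on_coords :: "'i set \<Rightarrow> nat \<Rightarrow> (('i \<Rightarrow> real) \<Rightarrow> real) \<Rightarrow> bool" where
  "Ck_on_coords I 0 f \<longleftrightarrow> continuous_on (I \<rightarrow>\<^sub>E UNIV) f"
| "Ck_on_coords I (Suc k) f \<longleftrightarrow>
     continuous_on (I \<rightarrow>\<^sub>E UNIV) f \<and>
     (\<forall>i\<in>I. \<exists>g. (\<forall>y \<in> I \<rightarrow>\<^sub>E UNIV. ((\<lambda>t. f (y(i := t))) has_real_derivative g y) (at (y i))) \<and>
                Ck_on_coords I k g)"

definition smooth_on_coords :: "'i set \<Rightarrow> (('i \<Rightarrow> real) \<Rightarrow> real) \<Rightarrow> bool" where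
  "smooth_on_coords I f \<longleftrightarrow> (\<forall>k. Ck_on_coords I k f)"

end

theory Submission
  imports Defs
begin

text \<open>
  The distribution factors as \<open>p\<^sub>A\<^sub>B(a, b) = p\<^sub>B(b) p(a | b)\<close>, and the parameters \<open>\<lambda>\<^bsub>A|B\<^esub>\<close>
  determine the second factor. By Moebius inversion, the sum \<open>S(a, b)\<close> of the parameters of all
  effects that meet \<open>A\<close> is \<open>ln p\<^sub>A\<^sub>B(a, b) - R(b)\<close>, where \<open>R(b)\<close> is the average of \<open>ln p\<^sub>A\<^sub>B(a, b)\<close>
  over \<open>a\<close> (lemma \<open>centred_log_conditional_cond_mll\<close>). Summing \<open>exp S\<close> over \<open>a\<close> gives
  \<open>ln p\<^sub>B(b) = R(b) + G(b)\<close> with the log normalizer \<open>G(b) = ln (\<Sum>a. exp S(a, b))\<close>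
  (lemma \<open>log_normalizer_cond_mll\<close>).

  For an effect \<open>L \<subseteq> B\<close>, averaging in two stages shows that the parameter in the margin \<open>A \<union> B\<close> is the
  interaction with effect \<open>L\<close> of the table \<open>R\<close> (lemma \<open>mean_on_tower\<close>), and the parameter in the
  margin \<open>B\<close> is by definition that of \<open>ln p\<^sub>B\<close>. Since interactions are linear in the table, \<open>f\<close> is
  minus the interaction of \<open>G\<close>. It is an expression in \<open>\<lambda>\<^bsub>A|B\<^esub>\<close> formed with sums, products,
  \<open>exp\<close> and logarithms of positive functions, hence smooth (lemma \<open>exp_log_fun_smooth\<close>).

  If \<open>X\<^sub>A\<close> is independent of \<open>X\<^sub>v\<close> given the other variables of \<open>B\<close>, then \<open>p(a | b)\<close> does not
  depend on the coordinate of \<open>b\<close> at \<open>v\<close>, and neither does \<open>G(b)\<close>, which is minus the average of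
  \<open>ln p(a | b)\<close> over \<open>a\<close> (lemma \<open>log_normalizer_cond_indep\<close>). An interaction whose effect contains a
  variable that the table ignores is zero (lemma \<open>interaction_eq_0\<close>).
\<close>

section \<open>Smoothness of exp-log expressions\<close>

text \<open>
  The correction term is built from finitely many coordinates by sums, products, \<open>exp\<close> and \<open>ln\<close>.
  This class of functions is chosen because it is closed under partial derivatives: the quotient that
  appears when \<open>ln\<close> is differentiated is again in the class, as \<open>1 / f = exp (- ln f)\<close>.
  One step of differentiation therefore settles derivatives of every order.
\<close>

inductive exp_log_fun :: "'i set \<Rightarrow> (('i \<Rightarrow> real) \<Rightarrow> real) \<Rightarrow> bool" for I where
  const: "exp_log_fun I (\<lambda>y. c)"
| coord: "i \<in> I \<Longrightarrow> exp_log_fun I (\<lambda>y. y i)"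
| add: "exp_log_fun I f \<Longrightarrow> exp_log_fun I g \<Longrightarrow> exp_log_fun I (\<lambda>y. f y + g y)"
| mult: "exp_log_fun I f \<Longrightarrow> exp_log_fun I g \<Longrightarrow> exp_log_fun I (\<lambda>y. f y * g y)"
| exp: "exp_log_fun I f \<Longrightarrow> exp_log_fun I (\<lambda>y. exp (f y))"
| ln: "exp_log_fun I f \<Longrightarrow> \<forall>y \<in> I \<rightarrow>\<^sub>E UNIV. f y > 0 \<Longrightarrow> exp_log_fun I (\<lambda>y. ln (f y))"

lemma exp_log_fun_sum:
  "(\<And>a. a \<in> S \<Longrightarrow> exp_log_fun I (f a)) \<Longrightarrow> exp_log_fun I (\<lambda>y. \<Sum>a\<in>S. f a y)"
  by (induction S rule: infinite_finite_induct) (auto intro: exp_log_fun.intros)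

lemma exp_log_fun_continuous:
  "exp_log_fun I f \<Longrightarrow> continuous_on (I \<rightarrow>\<^sub>E UNIV) f"
proof (induction rule: exp_log_fun.induct)
  case (coord i)
  show ?case
    by (rule continuous_on_subset[OF continuous_on_product_coordinates]) simp
next
  case (ln f)
  then show ?case by (intro continuous_on_ln) (auto simp: less_le)
qed (auto intro!: continuous_intros)

lemma exp_log_fun_partial_derivative:
  assumes "exp_log_fun I f" and i: "i \<in> I"
  shows "\<exists>g. exp_log_fun I g \<and>
    (\<forall>y \<in> I \<rightarrow>\<^sub>E UNIV. ((\<lambda>t. f (y(i := t))) has_real_derivative g y) (at (y i)))"
    (is "\<exists>g. exp_log_fun I g \<and> ?partial f g")
  using assms(1)
proof (induction rule: exp_log_fun.induct)
  case (const c)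
  have "?partial (\<lambda>y. c) (\<lambda>y. 0)" by simp
  then show ?case using exp_log_fun.const by blast
next
  case (coord j)
  have "?partial (\<lambda>y. y j) (\<lambda>y. if i = j then 1 else 0)" by auto
  then show ?case using exp_log_fun.const by blast
next
  case (add f g)
  then obtain f' g' where *: "exp_log_fun I f'" "exp_log_fun I g'" "?partial f f'" "?partial g g'"
    by blast
  have "?partial (\<lambda>y. f y + g y) (\<lambda>y. f' y + g' y)"
    using * by (intro ballI DERIV_add) blast+
  then show ?case using exp_log_fun.add[OF *(1,2)] by blast
next
  case (mult f g)
  then obtain f' g' where *: "exp_log_fun I f'" "exp_log_fun I g'" "?partial f f'" "?partial g g'"
    by blast
  have "?partial (\<lambda>y. f y * g y) (\<lambda>y. f' y * g y + g' y * f y)"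
  proof
    fix y :: "'a \<Rightarrow> real" assume y: "y \<in> I \<rightarrow>\<^sub>E UNIV"
    show "((\<lambda>t. f (y(i := t)) * g (y(i := t))) has_real_derivative
        f' y * g y + g' y * f y) (at (y i))"
      by (rule DERIV_cong[OF DERIV_mult[OF bspec[OF *(3) y] bspec[OF *(4) y]]]) simp
  qed
  moreover have "exp_log_fun I (\<lambda>y. f' y * g y + g' y * f y)"
    using * mult.hyps by (intro exp_log_fun.add exp_log_fun.mult)
  ultimately show ?case by blast
next
  case (exp f)
  then obtain f' where *: "exp_log_fun I f'" "?partial f f'" by blast
  have "?partial (\<lambda>y. exp (f y)) (\<lambda>y. exp (f y) * f' y)"
  proof
    fix y :: "'a \<Rightarrow> real" assume y: "y \<in> I \<rightarrow>\<^sub>E UNIV"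
    show "((\<lambda>t. exp (f (y(i := t)))) has_real_derivative exp (f y) * f' y) (at (y i))"
      by (rule DERIV_cong[OF DERIV_fun_exp[OF bspec[OF *(2) y]]]) simp
  qed
  moreover have "exp_log_fun I (\<lambda>y. exp (f y) * f' y)"
    using * exp.hyps by (intro exp_log_fun.mult exp_log_fun.exp)
  ultimately show ?case by blast
next
  case (ln f)
  then obtain f' where *: "exp_log_fun I f'" "?partial f f'" by blast
  have "?partial (\<lambda>y. ln (f y)) (\<lambda>y. exp (- 1 * ln (f y)) * f' y)"
  proof
    fix y :: "'a \<Rightarrow> real" assume y: "y \<in> I \<rightarrow>\<^sub>E UNIV"
    have pos: "f y > 0" using ln.hyps y by blast
    then have "f (y(i := y i)) > 0" by simp
    then show "((\<lambda>t. ln (f (y(i := t)))) has_real_derivative exp (- 1 * ln (f y)) * f' y) (at (y i))"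
      by (rule DERIV_cong[OF DERIV_chain2[OF DERIV_ln_divide bspec[OF *(2) y]]])
        (use pos in \<open>simp add: exp_minus divide_inverse\<close>)
  qed
  moreover have "exp_log_fun I (\<lambda>y. exp (- 1 * ln (f y)) * f' y)"
    using * ln.hyps by (intro exp_log_fun.mult exp_log_fun.exp exp_log_fun.ln exp_log_fun.const)
  ultimately show ?case by blast
qed

text \<open>
  Members of the class are continuous and their partial derivatives are members again, so induction
  on the order of differentiability applies with the function left arbitrary.
\<close>

lemma exp_log_fun_smooth:
  assumes "exp_log_fun I f"
  shows "smooth_on_coords I f"
proof -
  have "Ck_on_coords I k f" for k
    using assms
  proof (induction k arbitrary: f)
    case 0
    then show ?case by (simp add: exp_log_fun_continuous)
  next
    case (Suc k)
    then show ?case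
      using exp_log_fun_continuous[OF Suc.prems] exp_log_fun_partial_derivative[OF Suc.prems]
      by (simp; blast)
  qed
  then show ?thesis by (simp add: smooth_on_coords_def)
qed

section \<open>Means and interactions of a table\<close>

lemma restrict_eq_restrict_iff: "restrict x M = restrict y M \<longleftrightarrow> (\<forall>w\<in>M. x w = y w)"
  by (metis restrict_apply restrict_ext)

abbreviation slice :: "('v \<Rightarrow> nat) \<Rightarrow> 'v set \<Rightarrow> 'v set \<Rightarrow> ('v \<Rightarrow> nat) \<Rightarrow> ('v \<Rightarrow> nat) set" where
  "slice d M L x \<equiv> {j \<in> cells d M. restrict j L = x}"

text \<open>
  The parameters \<open>nu\<close> and \<open>mll\<close> are linear in the table \<open>\<lambda>j. ln (p\<^sub>M j)\<close>. The proof applies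
  the same linear maps to tables that are not logarithms of a distribution, such as the log normalizer
  below; hence mean and interaction are defined for an arbitrary table \<open>h\<close>.
\<close>

definition mean_on ::
  "('v \<Rightarrow> nat) \<Rightarrow> (('v \<Rightarrow> nat) \<Rightarrow> real) \<Rightarrow> 'v set \<Rightarrow> 'v set \<Rightarrow> ('v \<Rightarrow> nat) \<Rightarrow> real" where
  "mean_on d h M L x = 1 / real (card (cells d (M - L))) * (\<Sum>j \<in> slice d M L x. h j)"

definition interaction ::
  "('v \<Rightarrow> nat) \<Rightarrow> (('v \<Rightarrow> nat) \<Rightarrow> real) \<Rightarrow> 'v set \<Rightarrow> 'v set \<Rightarrow> ('v \<Rightarrow> nat) \<Rightarrow> real" where
  "interaction d h M L x =
     (\<Sum>L' \<in> Pow L. (-1) ^ card (L - L') * mean_on d h M L' (restrict x L'))"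

lemma nu_eq_mean_on: "nu d p M L x = mean_on d (\<lambda>j. ln (pmf (marginal p M) j)) M L x"
  by (simp add: nu_def mean_on_def)

lemma mll_eq_interaction:
  "mll d p M L x = interaction d (\<lambda>j. ln (pmf (marginal p M) j)) M L x"
  by (simp add: mll_def interaction_def nu_eq_mean_on)

lemma finite_cells: "finite M \<Longrightarrow> finite (cells d M)"
  by (auto simp: cells_def intro: finite_PiE)

lemma card_cells: "finite M \<Longrightarrow> card (cells d M) = (\<Prod>v\<in>M. d v)"
  by (simp add: cells_def card_PiE)

lemma restrict_cells: "j \<in> cells d M \<Longrightarrow> L \<subseteq> M \<Longrightarrow> restrict j L \<in> cells d L"
  by (auto simp: cells_def)

lemma restrict_cells_self: "j \<in> cells d M \<Longrightarrow> restrict j M = j"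
  by (simp add: cells_def)

lemma cells_update:
  "j \<in> cells d M \<Longrightarrow> v \<in> M \<Longrightarrow> t < d v \<Longrightarrow> j(v := t) \<in> cells d M"
  by (auto simp: cells_def PiE_iff extensional_def)

lemma card_slice:
  assumes "L \<subseteq> M" "x \<in> cells d L"
  shows "card (slice d M L x) = card (cells d (M - L))"
proof (rule bij_betw_same_card)
  have x: "restrict x L = x" using assms by (simp add: restrict_cells_self)
  have slice: "slice d M L x = {j \<in> cells d M. \<forall>w\<in>L. j w = x w}"
    using restrict_eq_restrict_iff[of _ L x] unfolding x by simp
  let ?join = "\<lambda>a w. if w \<in> L then x w else a w"
  show "bij_betw (\<lambda>j. restrict j (M - L)) (slice d M L x) (cells d (M - L))"
    unfolding slice
  proof (rule bij_betwI[where g = ?join])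
    show "(\<lambda>j. restrict j (M - L)) \<in> {j \<in> cells d M. \<forall>w\<in>L. j w = x w} \<rightarrow> cells d (M - L)"
      by (auto intro: restrict_cells)
    show "?join \<in> cells d (M - L) \<rightarrow> {j \<in> cells d M. \<forall>w\<in>L. j w = x w}"
      using assms by (auto simp: cells_def PiE_iff extensional_def)
    fix j assume "j \<in> {j \<in> cells d M. \<forall>w\<in>L. j w = x w}"
    then show "?join (restrict j (M - L)) = j"
      by (intro ext) (simp add: cells_def PiE_iff extensional_def)
  next
    fix a assume "a \<in> cells d (M - L)"
    then show "restrict (?join a) (M - L) = a"
      by (intro ext) (simp add: cells_def PiE_iff extensional_def)
  qed
qed

lemma mean_on_diff:
  "mean_on d (\<lambda>j. g j - h j) M L x = mean_on d g M L x - mean_on d h M L x"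
  by (simp add: mean_on_def sum_subtractf right_diff_distrib)

lemma mean_on_const:
  assumes "finite M" "L \<subseteq> M" "x \<in> cells d L" "\<forall>v\<in>M. d v \<noteq> 0"
  shows "mean_on d (\<lambda>j. c) M L x = c"
  using assms by (simp add: mean_on_def card_slice card_cells finite_subset subset_eq)

lemma mean_on_cong:
  "(\<And>j. j \<in> slice d M L x \<Longrightarrow> g j = h j) \<Longrightarrow> mean_on d g M L x = mean_on d h M L x"
  by (auto simp: mean_on_def intro!: sum.cong)

lemma interaction_diff:
  "interaction d (\<lambda>j. g j - h j) M L x = interaction d g M L x - interaction d h M L x"
  by (simp add: interaction_def mean_on_diff sum_subtractf right_diff_distrib)

lemma interaction_cong:
  "(\<And>j. j \<in> cells d M \<Longrightarrow> g j = h j) \<Longrightarrow> interaction d g M L x = interaction d h M L x"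
  unfolding interaction_def
  by (intro sum.cong refl arg_cong2[where f = "(*)"] mean_on_cong) auto

text \<open>
  Interactions are the Moebius transform of the means over the lattice of effects, and this is the
  inversion formula. With \<open>L = M\<close> it recovers the table from its interactions; with a smaller \<open>L\<close>
  it gives its average over the remaining variables.
\<close>

lemma sum_interaction:
  assumes "finite L"
  shows "(\<Sum>K\<in>Pow L. interaction d h M K (restrict x K)) = mean_on d h M L (restrict x L)"
proof -
  let ?f = "\<lambda>K. mean_on d h M K (restrict x K)"
  let ?i = "\<lambda>K. interaction d h M K (restrict x K)"
  have cancel: "(-1) ^ n * ((-1) ^ n * z) = z" for n and z :: real
    by (cases "even n") simp_all
  have "(-1) ^ card S * ?i S = (\<Sum>T\<in>Pow S. (-1) ^ card T * ?f T)" if S: "finite S" for S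
  proof -
    have "(-1) ^ card S * ((-1) ^ card (S - T) * ?f T) = (-1) ^ card T * ?f T" if "T \<subseteq> S" for T
    proof -
      have "card S = card (S - T) + card T"
        using S that by (metis card_Diff_subset card_mono finite_subset le_add_diff_inverse2)
      then have "(-1) ^ card S = (-1) ^ card (S - T) * ((-1) ^ card T :: real)"
        by (metis power_add)
      then show ?thesis by (metis cancel mult.assoc mult.commute)
    qed
    then show ?thesis
      unfolding interaction_def sum_distrib_left
      by (intro sum.cong refl) (simp add: Int_absorb1)
  qed
  then have "?f L = (\<Sum>T\<in>Pow L. (-1) ^ card T * ((-1) ^ card T * ?i T))"
    using assms by (rule inclusion_exclusion_symmetric)
  then show ?thesis by (simp only: cancel)
qed

text \<open>
  Averaging out \<open>M - L\<close> can be done in two stages, first \<open>M - B\<close> and then \<open>B - L\<close>. This moves an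
  interaction with effect inside \<open>B\<close> from the margin \<open>M\<close> to the margin \<open>B\<close>.
\<close>

lemma mean_on_tower:
  assumes M: "finite M" and BM: "B \<subseteq> M" and LB: "L \<subseteq> B"
  shows "mean_on d h M L x = mean_on d (\<lambda>b. mean_on d h M B b) B L x"
proof -
  have "(\<Sum>b\<in>slice d B L x. \<Sum>j\<in>slice d M B b. h j) =
        (\<Sum>b\<in>slice d B L x. \<Sum>j\<in>{j \<in> slice d M L x. restrict j B = b}. h j)"
    using LB by (intro sum.cong) (auto simp: Int_absorb1 Int_absorb2)
  also have "\<dots> = (\<Sum>j\<in>slice d M L x. h j)"
    using assms finite_subset[OF BM M]
    by (intro sum.group) (auto simp: finite_cells restrict_cells Int_absorb1 Int_absorb2)
  finally have sums: "(\<Sum>b\<in>slice d B L x. \<Sum>j\<in>slice d M B b. h j) = (\<Sum>j\<in>slice d M L x. h j)" .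
  have "M - L = (M - B) \<union> (B - L)" using BM LB by auto
  then have "(\<Prod>v\<in>M - L. d v) = (\<Prod>v\<in>M - B. d v) * (\<Prod>v\<in>B - L. d v)"
    using M finite_subset[OF BM M] by (simp only:) (rule prod.union_disjoint, auto)
  then have "card (cells d (M - L)) = card (cells d (M - B)) * card (cells d (B - L))"
    using M finite_subset[OF BM M] by (simp add: card_cells)
  then show ?thesis
    by (simp add: mean_on_def sums flip: sum_distrib_left sum_divide_distrib)
qed

text \<open>
  Fixing the value of a variable that \<open>h\<close> ignores does not change the mean: each cell with
  \<open>v\<close>-coordinate \<open>x v\<close> stands for the \<open>d v\<close> cells that differ from it only at \<open>v\<close>.
\<close>

lemma mean_on_insert:
  assumes B: "finite B" and L: "v \<notin> L" "insert v L \<subseteq> B" and x: "x v < d v"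
    and h: "\<And>b b'. b \<in> cells d B \<Longrightarrow> b' \<in> cells d B \<Longrightarrow>
      restrict b (B - {v}) = restrict b' (B - {v}) \<Longrightarrow> h b = h b'"
  shows "mean_on d h B L (restrict x L) =
         mean_on d h B (insert v L) (restrict x (insert v L))"
proof -
  let ?F = "slice d B (insert v L) (restrict x (insert v L))"
  have "(\<Sum>j\<in>slice d B L (restrict x L). h j) = (\<Sum>(b, t)\<in>?F \<times> {..<d v}. h b)"
  proof (rule sum.reindex_bij_witness[where i = "\<lambda>(b, t). b(v := t)"
        and j = "\<lambda>b. (b(v := x v), b v)"])
    fix b assume b: "b \<in> slice d B L (restrict x L)"
    have "b(v := x v) \<in> cells d B" using b L x by (auto intro: cells_update)
    moreover have "b v < d v" using b L by (auto simp: cells_def)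
    moreover have "restrict (b(v := x v)) (insert v L) = restrict x (insert v L)"
      using b L by (auto simp: restrict_eq_restrict_iff)
    ultimately show "(b(v := x v), b v) \<in> ?F \<times> {..<d v}" by simp
    then show "(case (b(v := x v), b v) of (b, t) \<Rightarrow> h b) = h b"
      using b by (auto intro!: h simp: fun_eq_iff)
    show "(case (b(v := x v), b v) of (b, t) \<Rightarrow> b(v := t)) = b" by simp
  next
    fix bt assume bt: "bt \<in> ?F \<times> {..<d v}"
    obtain b t where [simp]: "bt = (b, t)" by fastforce
    have b: "b \<in> cells d B" "t < d v" and eq: "\<forall>w\<in>insert v L. b w = x w"
      using bt by (simp_all add: restrict_eq_restrict_iff)
    have "restrict (b(v := t)) L = restrict x L"
      using L eq by (auto simp: restrict_eq_restrict_iff)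
    moreover have "b(v := t) \<in> cells d B"
      using b L by (intro cells_update) auto
    ultimately    show "(case bt of (b, t) \<Rightarrow> b(v := t)) \<in> slice d B L (restrict x L)"
      by simp
    show "((case bt of (b, t) \<Rightarrow> b(v := t))(v := x v), (case bt of (b, t) \<Rightarrow> b(v := t)) v) = bt"
      using eq by (auto simp: fun_eq_iff)
  qed
  also have "\<dots> = real (d v) * (\<Sum>j\<in>?F. h j)"
    by (simp add: sum.cartesian_product[symmetric] sum_distrib_left)
  finally have sums: "(\<Sum>j\<in>slice d B L (restrict x L). h j) = real (d v) * (\<Sum>j\<in>?F. h j)" .
  have "(\<Prod>w\<in>insert v (B - insert v L). d w) = d v * (\<Prod>w\<in>B - insert v L. d w)"
    using B by (intro prod.insert) auto
  also have "insert v (B - insert v L) = B - L" using L by auto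
  finally have "card (cells d (B - L)) = d v * card (cells d (B - insert v L))"
    using B by (simp add: card_cells)
  then show ?thesis using x by (simp add: mean_on_def sums)
qed

text \<open>
  The effects \<open>K\<close> and \<open>insert v K\<close> have equal means by the previous lemma and opposite signs in the
  alternating sum, so they cancel in pairs.
\<close>

lemma interaction_eq_0:
  assumes B: "finite B" and L: "v \<in> L" "L \<subseteq> B" and x: "x v < d v"
    and h: "\<And>b b'. b \<in> cells d B \<Longrightarrow> b' \<in> cells d B \<Longrightarrow>
      restrict b (B - {v}) = restrict b' (B - {v}) \<Longrightarrow> h b = h b'"
  shows "interaction d h B L x = 0"
proof -
  define L0 where "L0 = L - {v}"
  have L0: "L = insert v L0" "v \<notin> L0" using L by (auto simp: L0_def)
  have fin: "finite L0" using B L by (auto simp: L0_def intro: finite_subset)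
  let ?m = "\<lambda>K. mean_on d h B K (restrict x K)"
  have inj: "inj_on (insert v) (Pow L0)" using L0 by (auto simp: inj_on_def)
  have "interaction d h B L x =
    (\<Sum>K\<in>Pow L0. (-1) ^ card (L - K) * ?m K) + (\<Sum>K\<in>insert v ` Pow L0. (-1) ^ card (L - K) * ?m K)"
    unfolding interaction_def L0(1) Pow_insert
    using fin L0(2) by (intro sum.union_disjoint) auto
  also have "\<dots> = (\<Sum>K\<in>Pow L0. (-1) ^ card (L - K) * ?m K +
                              (-1) ^ card (L - insert v K) * ?m (insert v K))"
    by (simp add: sum.reindex[OF inj] sum.distrib)
  also have "\<dots> = (\<Sum>K\<in>Pow L0. 0)"
  proof (intro sum.cong refl)
    fix K assume K: "K \<in> Pow L0"
    have "L - K = insert v (L0 - K)" "L - insert v K = L0 - K" using L0 K by auto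
    moreover have "?m K = ?m (insert v K)"
      using K L L0 by (intro mean_on_insert B x h) auto
    ultimately show "(-1) ^ card (L - K) * ?m K + (-1) ^ card (L - insert v K) * ?m (insert v K) = 0"
      using fin L0(2) by simp
  qed
  finally show ?thesis by simp
qed

section \<open>Marginals and conditional independence\<close>

lemma set_pmf_marginal:
  assumes p: "set_pmf p = cells d V" and M: "M \<subseteq> V" and d: "\<forall>v\<in>V. d v \<noteq> 0"
  shows "set_pmf (marginal p M) = cells d M"
proof -
  have "y \<in> (\<lambda>x. restrict x M) ` cells d V" if y: "y \<in> cells d M" for y
  proof (rule image_eqI)
    let ?x = "\<lambda>w. if w \<in> M then y w else if w \<in> V then 0 else undefined"
    show "?x \<in> cells d V" using y M d by (auto simp: cells_def PiE_iff extensional_def)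
    show "y = restrict ?x M" using y by (auto simp: cells_def PiE_iff extensional_def)
  qed
  then show ?thesis using M by (auto simp: marginal_def p restrict_cells)
qed

lemma pmf_marginal_sum:
  assumes V: "finite V" and p: "set_pmf p = cells d V" and BM: "B \<subseteq> M" "M \<subseteq> V"
    and d: "\<forall>v\<in>V. d v \<noteq> 0"
  shows "pmf (marginal p B) b = (\<Sum>j\<in>slice d M B b. pmf (marginal p M) j)"
proof -
  have "marginal p B = map_pmf (\<lambda>j. restrict j B) (marginal p M)"
    using BM by (simp add: marginal_def map_pmf_comp Int_absorb1)
  then have "pmf (marginal p B) b =
    measure_pmf.prob (marginal p M) ((\<lambda>j. restrict j B) -` {b} \<inter> set_pmf (marginal p M))"
    by (simp add: pmf_map measure_Int_set_pmf)
  also have "(\<lambda>j. restrict j B) -` {b} \<inter> set_pmf (marginal p M) = slice d M B b"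
    by (auto simp: set_pmf_marginal[OF p BM(2) d])
  also have "measure_pmf.prob (marginal p M) \<dots> = (\<Sum>j\<in>slice d M B b. pmf (marginal p M) j)"
    using BM V by (intro measure_measure_pmf_finite) (auto simp: finite_cells finite_subset)
  finally show ?thesis .
qed

text \<open>
  Writing cells as restrictions \<open>restrict j M\<close> of one common \<open>j\<close> turns all marginal probabilities
  of a factorization into probabilities of events of one shape, whose intersections are unions of
  index sets.
\<close>

lemma pmf_marginal_restrict:
  "pmf (marginal p M) (restrict j M) = measure_pmf.prob p {x. \<forall>w\<in>M. x w = j w}"
proof -
  have "(\<lambda>x. restrict x M) -` {restrict j M} = {x. \<forall>w\<in>M. x w = j w}"
    by (auto simp: restrict_eq_restrict_iff)
  then show ?thesis by (simp add: marginal_def pmf_map)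
qed

lemma measure_cond_pmf:
  assumes "set_pmf p \<inter> S \<noteq> {}"
  shows "measure_pmf.prob (cond_pmf p S) E = measure_pmf.prob p (S \<inter> E) / measure_pmf.prob p S"
  unfolding cond_pmf.rep_eq[OF assms]
  using emeasure_measure_pmf_not_zero[OF assms] by (subst measure_uniform_measure) auto

text \<open>
  The product form of conditional independence, with denominators cleared. It also holds on the cells
  where the conditioning event has probability zero, because both sides vanish there.
\<close>

lemma cond_indep_factorization:
  assumes ci: "cond_indep p A C D"
  shows "pmf (marginal p (A \<union> C \<union> D)) (restrict j (A \<union> C \<union> D)) * pmf (marginal p D) (restrict j D) =
         pmf (marginal p (A \<union> D)) (restrict j (A \<union> D)) * pmf (marginal p (C \<union> D)) (restrict j (C \<union> D))"
proof (cases "restrict j D \<in> set_pmf (marginal p D)")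
  case True
  define S where "S = {x. restrict x D = restrict j D}"
  let ?E = "\<lambda>M. {x. \<forall>w\<in>M. x w = j w}"
  have S: "S = ?E D" by (auto simp: S_def restrict_eq_restrict_iff)
  have nz: "set_pmf p \<inter> S \<noteq> {}" using True by (auto simp: marginal_def S_def)
  have A: "(\<lambda>x. restrict x A) -` {restrict j A} = ?E A"
    and C: "(\<lambda>x. restrict x C) -` {restrict j C} = ?E C"
    and AC: "(\<lambda>x. (restrict x A, restrict x C)) -` {(restrict j A, restrict j C)} = ?E (A \<union> C)"
    by (auto simp: restrict_eq_restrict_iff)
  have "prob_space.indep_var (measure_pmf (cond_pmf p S))
      (count_space UNIV) (\<lambda>x. restrict x A) (count_space UNIV) (\<lambda>x. restrict x C)"
    using ci True unfolding cond_indep_def S_def by blast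
  from prob_space.indep_varD[OF prob_space_measure_pmf this,
      of "{restrict j A}" "{restrict j C}"]
  have "measure_pmf.prob (cond_pmf p S) (?E (A \<union> C)) =
        measure_pmf.prob (cond_pmf p S) (?E A) * measure_pmf.prob (cond_pmf p S) (?E C)"
    by (simp add: A C AC)
  moreover have "S \<inter> ?E M = ?E (M \<union> D)" for M by (auto simp: S)
  ultimately show ?thesis
    using measure_measure_pmf_not_zero[OF nz]
    by (simp add: measure_cond_pmf[OF nz] pmf_marginal_restrict field_simps flip: S)
next
  case False
  have "measure_pmf.prob p {x. \<forall>w\<in>A \<union> D. x w = j w} \<le> pmf (marginal p D) (restrict j D)"
    unfolding pmf_marginal_restrict by (intro measure_pmf.finite_measure_mono) auto
  with False show ?thesis
    by (simp add: set_pmf_iff pmf_marginal_restrict[of p "A \<union> D"] measure_le_0_iff)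
qed

section \<open>The log normalizer of the conditional distribution\<close>

text \<open>
  At \<open>y = \<lambda>\<^bsub>A|B\<^esub>\<close> this is \<open>ln p(j\<^sub>A | j\<^sub>B)\<close> minus its average over \<open>j\<^sub>A\<close>. It is defined from
  the coordinates \<open>y\<close> alone, so that what is derived from it is a function of the parameters and does
  not refer to the distribution.
\<close>

definition centred_log_conditional ::
  "'v set \<Rightarrow> 'v set \<Rightarrow> ('v set \<times> ('v \<Rightarrow> nat) \<Rightarrow> real) \<Rightarrow> ('v \<Rightarrow> nat) \<Rightarrow> real" where
  "centred_log_conditional A B y j = (\<Sum>K\<in>{K. K \<subseteq> A \<union> B \<and> K \<inter> A \<noteq> {}}. y (K, restrict j K))"

text \<open>
  The conditional distribution given \<open>X\<^sub>B = b\<close> is proportional to the exponential of the centred log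
  conditional; this is the logarithm of the constant of proportionality.
\<close>

definition log_normalizer ::
  "('v \<Rightarrow> nat) \<Rightarrow> 'v set \<Rightarrow> 'v set \<Rightarrow> ('v set \<times> ('v \<Rightarrow> nat) \<Rightarrow> real) \<Rightarrow> ('v \<Rightarrow> nat) \<Rightarrow> real" where
  "log_normalizer d A B y b = ln (\<Sum>j\<in>slice d (A \<union> B) B b. exp (centred_log_conditional A B y j))"

text \<open>
  Moebius inversion over all effects in \<open>A \<union> B\<close> gives the log probability, and over the effects
  inside \<open>B\<close> its average over the variables in \<open>A\<close>. The effects that meet \<open>A\<close> are those in the
  difference.
\<close>

lemma centred_log_conditional_cond_mll:
  fixes p :: "('v \<Rightarrow> nat) pmf" and A B :: "'v set"
  defines "h \<equiv> (\<lambda>j. ln (pmf (marginal p (A \<union> B)) j))"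
  assumes fin: "finite (A \<union> B)" and AB: "A \<inter> B = {}" and j: "j \<in> cells d (A \<union> B)"
  shows "centred_log_conditional A B (cond_mll d p A B) j =
         h j - mean_on d h (A \<union> B) B (restrict j B)"
proof -
  let ?i = "\<lambda>K. interaction d h (A \<union> B) K (restrict j K)"
  let ?E = "{K. K \<subseteq> A \<union> B \<and> K \<inter> A \<noteq> {}}"
  have "centred_log_conditional A B (cond_mll d p A B) j = (\<Sum>K\<in>?E. ?i K)"
    unfolding centred_log_conditional_def
  proof (intro sum.cong refl)
    fix K assume K: "K \<in> ?E"
    then have "(K, restrict j K) \<in> cond_mll_index d A B"
      using j by (auto simp: cond_mll_index_def intro: restrict_cells)
    then show "cond_mll d p A B (K, restrict j K) = ?i K"
      by (simp add: cond_mll_def mll_eq_interaction h_def)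
  qed
  moreover have "(\<Sum>K\<in>Pow (A \<union> B). ?i K) = (\<Sum>K\<in>?E. ?i K) + (\<Sum>K\<in>Pow B. ?i K)"
  proof -
    have "Pow (A \<union> B) = ?E \<union> Pow B" "?E \<inter> Pow B = {}" using AB by auto
    moreover have "finite ?E" "finite (Pow B)"
      using fin by (auto intro: finite_subset[of _ "Pow (A \<union> B)"])
    ultimately show ?thesis by (simp only: sum.union_disjoint)
  qed
  moreover have "(\<Sum>K\<in>Pow (A \<union> B). ?i K) = mean_on d h (A \<union> B) (A \<union> B) j"
    using fin j by (simp add: sum_interaction restrict_cells_self)
  moreover have "(\<Sum>K\<in>Pow B. ?i K) = mean_on d h (A \<union> B) B (restrict j B)"
    using fin by (intro sum_interaction) auto
  moreover have "mean_on d h (A \<union> B) (A \<union> B) j = h j"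
  proof -
    have "slice d (A \<union> B) (A \<union> B) j = {j}"
      using j by (auto simp: restrict_cells_self)
    moreover have "card (cells d {}) = 1" by (simp add: card_cells)
    ultimately show ?thesis by (simp add: mean_on_def)
  qed
  ultimately show ?thesis by simp
qed

text \<open>
  Exponentiating the previous lemma and summing over the cells above \<open>b\<close> turns the joint
  probabilities into \<open>p\<^sub>B b\<close>, while the average of the log probabilities is constant on these cells
  and factors out.
\<close>

lemma log_normalizer_cond_mll:
  fixes p :: "('v \<Rightarrow> nat) pmf" and A B :: "'v set"
  defines "h \<equiv> (\<lambda>j. ln (pmf (marginal p (A \<union> B)) j))"
  assumes V: "finite V" and AV: "A \<subseteq> V" and BV: "B \<subseteq> V" and AB: "A \<inter> B = {}"
    and d: "\<forall>v\<in>V. d v \<noteq> 0" and p: "set_pmf p = cells d V" and b: "b \<in> cells d B"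
  shows "log_normalizer d A B (cond_mll d p A B) b =
         ln (pmf (marginal p B) b) - mean_on d h (A \<union> B) B b"
proof -
  have ABV: "A \<union> B \<subseteq> V" and fin: "finite (A \<union> B)" using AV BV V finite_subset by auto
  have pos: "pmf (marginal p M) j > 0" if "j \<in> cells d M" "M \<subseteq> V" for M j
    using that set_pmf_marginal[OF p that(2) d] by (auto intro: pmf_positive)
  let ?R = "mean_on d h (A \<union> B) B b"
  have "(\<Sum>j\<in>slice d (A \<union> B) B b. exp (centred_log_conditional A B (cond_mll d p A B) j)) =
        (\<Sum>j\<in>slice d (A \<union> B) B b. pmf (marginal p (A \<union> B)) j / exp ?R)"
  proof (intro sum.cong refl)
    fix j assume "j \<in> slice d (A \<union> B) B b"
    then show "exp (centred_log_conditional A B (cond_mll d p A B) j) =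
        pmf (marginal p (A \<union> B)) j / exp ?R"
      using centred_log_conditional_cond_mll[OF fin AB, of j d p] pos[OF _ ABV]
      by (auto simp: h_def exp_diff)
  qed
  also have "\<dots> = pmf (marginal p B) b / exp ?R"
    using pmf_marginal_sum[OF V p _ ABV d, of B b] by (simp add: sum_divide_distrib)
  finally show ?thesis
    using pos[OF b BV] by (simp add: log_normalizer_def ln_div)
qed

text \<open>
  Under the conditional independence, \<open>ln p\<^sub>A\<^sub>B = ln p\<^sub>B + (ln p\<^sub>W - ln p\<^sub>D)\<close> with
  \<open>D = B - {v}\<close> and \<open>W = A \<union> D\<close>. Averaging over \<open>A\<close> and subtracting from \<open>ln p\<^sub>B\<close> cancels the only
  term that involves the value at \<open>v\<close>.
\<close>

lemma log_normalizer_cond_indep: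
  assumes V: "finite V" and AV: "A \<subseteq> V" and BV: "B \<subseteq> V" and AB: "A \<inter> B = {}"
    and d: "\<forall>v\<in>V. d v \<noteq> 0" and p: "set_pmf p = cells d V"
    and v: "v \<in> B" and ci: "cond_indep p A {v} (B - {v})"
    and b: "b \<in> cells d B" "b' \<in> cells d B" and eq: "restrict b (B - {v}) = restrict b' (B - {v})"
  shows "log_normalizer d A B (cond_mll d p A B) b = log_normalizer d A B (cond_mll d p A B) b'"
proof -
  let ?lp = "\<lambda>M j. ln (pmf (marginal p M) (restrict j M))"
  let ?D = "B - {v}" and ?W = "A \<union> (B - {v})"
  have ABV: "A \<union> B \<subseteq> V" and fin: "finite (A \<union> B)" using AV BV V finite_subset by auto
  have vA: "v \<notin> A" using AB v by auto
  have Un: "A \<union> {v} \<union> ?D = A \<union> B" "{v} \<union> ?D = B" using v by auto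
  have factor: "?lp (A \<union> B) j = ?lp B j + (?lp ?W j - ?lp ?D j)" if j: "j \<in> cells d (A \<union> B)" for j
  proof -
    have pos: "pmf (marginal p M) (restrict j M) > 0" if "M \<subseteq> A \<union> B" for M
      using that ABV set_pmf_marginal[OF p _ d, of M] restrict_cells[OF j that]
      by (auto intro: pmf_positive)
    have "?lp (A \<union> B) j + ?lp ?D j = ?lp ?W j + ?lp B j"
      using arg_cong[OF cond_indep_factorization[OF ci, of j], of ln]
        pos[OF subset_refl] pos[of ?D, OF le_supI2[OF Diff_subset]]
        pos[of ?W, OF Un_mono[OF subset_refl Diff_subset]] pos[of B, OF Un_upper2]
      unfolding Un by (simp only: ln_mult_pos)
    then show ?thesis by simp
  qed
  have ln_eq: "log_normalizer d A B (cond_mll d p A B) c =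
      ?lp ?D c - mean_on d (?lp ?W) (A \<union> B) B c" if c: "c \<in> cells d B" for c
  proof -
    have "mean_on d (\<lambda>j. ln (pmf (marginal p (A \<union> B)) j)) (A \<union> B) B c =
          mean_on d (\<lambda>j. ?lp ?W j - (?lp ?D c - ?lp B c)) (A \<union> B) B c"
    proof (rule mean_on_cong)
      fix j assume j: "j \<in> slice d (A \<union> B) B c"
      then have "restrict j ?D = restrict c ?D"
        by (auto simp: Int_absorb1)
      moreover have "restrict j B = restrict c B" "restrict j (A \<union> B) = j"
        using j by (auto simp: restrict_cells_self)
      ultimately show "ln (pmf (marginal p (A \<union> B)) j) = ?lp ?W j - (?lp ?D c - ?lp B c)"
        using factor[of j] j by simp
    qed
    also have "\<dots> = mean_on d (?lp ?W) (A \<union> B) B c - (?lp ?D c - ?lp B c)"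
      using fin c d ABV by (subst mean_on_diff, subst mean_on_const) auto
    finally show ?thesis
      using log_normalizer_cond_mll[OF V AV BV AB d p c] c by (simp add: restrict_cells_self)
  qed
  \<comment> \<open>changing the value at \<open>v\<close> matches the cells above \<open>b\<close> with those above \<open>b'\<close>, in both directions\<close>
  have move: "j(v := c' v) \<in> slice d (A \<union> B) B c'" "restrict (j(v := c' v)) ?W = restrict j ?W"
    "(j(v := c' v))(v := c v) = j"
    if "j \<in> slice d (A \<union> B) B c" "c \<in> cells d B" "c' \<in> cells d B" "restrict c ?D = restrict c' ?D"
    for j c c'
  proof -
    have "c' v < d v" using that(3) v by (auto simp: cells_def)
    then have "j(v := c' v) \<in> cells d (A \<union> B)" using that(1) v by (auto intro: cells_update)
    moreover have jc: "\<forall>w\<in>B. j w = c w"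
      using that(1,2) by auto
    then have "\<forall>w\<in>B. (j(v := c' v)) w = c' w"
      using that(4) unfolding restrict_eq_restrict_iff by auto
    then have "restrict (j(v := c' v)) B = restrict c' B"
      unfolding restrict_eq_restrict_iff .
    ultimately show "j(v := c' v) \<in> slice d (A \<union> B) B c'"
      using that(3) by (simp add: restrict_cells_self)
    show "restrict (j(v := c' v)) ?W = restrict j ?W"
      using vA by (auto simp: restrict_eq_restrict_iff)
    show "(j(v := c' v))(v := c v) = j" using jc v by (auto simp: fun_eq_iff)
  qed
  have "(\<Sum>j\<in>slice d (A \<union> B) B b. ?lp ?W j) = (\<Sum>j\<in>slice d (A \<union> B) B b'. ?lp ?W j)"
    by (rule sum.reindex_bij_witness[where i = "\<lambda>j. j(v := b v)" and j = "\<lambda>j. j(v := b' v)"])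
      (use move[OF _ b eq] move[OF _ b(2,1) eq[symmetric]] in \<open>simp_all only:\<close>)
  then show ?thesis using ln_eq[OF b(1)] ln_eq[OF b(2)] eq by (simp add: mean_on_def)
qed

text \<open>
  The argument of the logarithm is a nonempty sum of exponentials, so it is positive for every
  parameter vector, including vectors that do not come from a distribution.
\<close>

lemma exp_log_fun_log_normalizer:
  assumes fin: "finite (A \<union> B)" and d: "\<forall>v\<in>A \<union> B. d v \<noteq> 0" and b: "b \<in> cells d B"
  shows "exp_log_fun (cond_mll_index d A B) (\<lambda>y. log_normalizer d A B y b)"
  unfolding log_normalizer_def
proof (rule exp_log_fun.ln)
  show "exp_log_fun (cond_mll_index d A B)
      (\<lambda>y. \<Sum>j\<in>slice d (A \<union> B) B b. exp (centred_log_conditional A B y j))"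
    unfolding centred_log_conditional_def
    by (intro exp_log_fun_sum exp_log_fun.exp exp_log_fun.coord)
      (auto simp: cond_mll_index_def intro: restrict_cells)
  have "card (slice d (A \<union> B) B b) > 0"
    using fin d b by (auto simp: card_slice card_cells)
  then show "\<forall>y \<in> cond_mll_index d A B \<rightarrow>\<^sub>E UNIV.
      (\<Sum>j\<in>slice d (A \<union> B) B b. exp (centred_log_conditional A B y j)) > 0"
    by (auto simp: card_gt_0_iff intro!: sum_pos)
qed

section \<open>Decomposition of the parameter\<close>

theorem theorem5p1:
  fixes V A B L :: "'v set" and d :: "'v \<Rightarrow> nat"
  assumes "finite V" and "A \<subseteq> V" and "B \<subseteq> V" and "A \<inter> B = {}"
    and "\<forall>v\<in>V. d v \<ge> 2"
    and "L \<subseteq> B"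
  shows "\<forall>x \<in> cells d L. \<exists>f.
           smooth_on_coords (cond_mll_index d A B) f \<and>
           (\<forall>p :: ('v \<Rightarrow> nat) pmf. set_pmf p = cells d V \<longrightarrow>
              mll d p (A \<union> B) L x = mll d p B L x + f (cond_mll d p A B) \<and>
              ((\<exists>v\<in>L. cond_indep p A {v} (B - {v})) \<longrightarrow> f (cond_mll d p A B) = 0))"
proof
  fix x assume x: "x \<in> cells d L"
  have d: "\<forall>v\<in>V. d v \<noteq> 0" using assms(5) by auto
  have fin: "finite B" "finite (A \<union> B)" using assms(1-3) finite_subset by auto
  let ?f = "\<lambda>y. - 1 * interaction d (log_normalizer d A B y) B L x"
  have "exp_log_fun (cond_mll_index d A B) ?f"
    unfolding interaction_def mean_on_def
    using fin d assms(2,3)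
    by (intro exp_log_fun.mult exp_log_fun.const exp_log_fun_sum exp_log_fun_log_normalizer) auto
  then have smooth: "smooth_on_coords (cond_mll_index d A B) ?f"
    by (rule exp_log_fun_smooth)
  have "mll d p (A \<union> B) L x = mll d p B L x + ?f (cond_mll d p A B)"
    if p: "set_pmf p = cells d V" for p
  proof -
    let ?h = "\<lambda>j. ln (pmf (marginal p (A \<union> B)) j)"
    have "mll d p (A \<union> B) L x = interaction d (\<lambda>b. mean_on d ?h (A \<union> B) B b) B L x"
      using fin assms(6) unfolding mll_eq_interaction interaction_def
      by (intro sum.cong refl arg_cong2[where f = "(*)"] mean_on_tower) auto
    also have "\<dots> = interaction d (\<lambda>b. ln (pmf (marginal p B) b) -
        log_normalizer d A B (cond_mll d p A B) b) B L x"
      using log_normalizer_cond_mll[OF assms(1-4) d p] by (intro interaction_cong) simp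
    finally show ?thesis by (simp add: interaction_diff mll_eq_interaction)
  qed
  moreover have "?f (cond_mll d p A B) = 0"
    if p: "set_pmf p = cells d V" and v: "v \<in> L" "cond_indep p A {v} (B - {v})" for p v
  proof -
    have "v \<in> B" "x v < d v" using v assms(6) x by (auto simp: cells_def)
    then have "interaction d (log_normalizer d A B (cond_mll d p A B)) B L x = 0"
      by (intro interaction_eq_0[OF fin(1) v(1) assms(6)]
          log_normalizer_cond_indep[OF assms(1-4) d p _ v(2)])
    then show ?thesis by simp
  qed
  ultimately show "\<exists>f. smooth_on_coords (cond_mll_index d A B) f \<and>
       (\<forall>p. set_pmf p = cells d V \<longrightarrow>
          mll d p (A \<union> B) L x = mll d p B L x + f (cond_mll d p A B) \<and>
          ((\<exists>v\<in>L. cond_indep p A {v} (B - {v})) \<longrightarrow> f (cond_mll d p A B) = 0))"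
    using smooth by (intro exI[of _ ?f]) blast
qed

end
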